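(* Given $a,b,\ell\in\mathbb{R}^+$, consider the rectangular grid with parameters $a,b$ and a uniformly random segment of length $\ell$. The average (expected) number $\varphi(\ell)$ of tiles visited by the segment is $$\varphi(\ell) = \frac{2\ell}{\pi}\left(\frac1a+\frac1b\right)+1 .$$
   Context: $\mathbb{R}^+=(0,\infty)$. The grid with parameters $a,b\in\mathbb{R}^+$ consists of the lines $x=ka$ and $y=kb$, $k\in\mathbb{Z}$, in $\mathbb{R}^2$; its tiles are the rectangles $[ka,(k+1)a]\times[mb,(m+1)b]$, $k,m\in\mathbb{Z}$. A line segment visits a tile if it intersects the interior of the tile. A uniformly random segment of length $\ell$ is the segment with endpoints $(x_1,y_1)$ and $(x_2,y_2)=(x_1+\ell\cos\theta,\,y_1+\ell\sin\theta)$, where $x_1,y_1,\theta$ are independent random variables uniformly distributed on $[0,a)$, $[0,b)$ and $[0,2\pi)$ respectively. *)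

theory Defs
  imports "HOL-Probability.Probability"
begin

definition tile :: "real \<Rightarrow> real \<Rightarrow> int \<Rightarrow> int \<Rightarrow> (real \<times> real) set" where
  "tile a b k m =
     {of_int k * a .. (of_int k + 1) * a} \<times> {of_int m * b .. (of_int m + 1) * b}"

definition tiles :: "real \<Rightarrow> real \<Rightarrow> (real \<times> real) set set" where
  "tiles a b = {tile a b k m | k m. True}"

definition visits :: "(real \<times> real) set \<Rightarrow> (real \<times> real) set \<Rightarrow> bool" where
  "visits S T \<longleftrightarrow> S \<inter> interior T \<noteq> {}"

definition segment :: "real \<Rightarrow> real \<Rightarrow> real \<Rightarrow> real \<Rightarrow> (real \<times> real) set" where
  "segment l x y \<theta> = closed_segment (x, y) (x + l * cos \<theta>, y + l * sin \<theta>)"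

definition num_visited :: "real \<Rightarrow> real \<Rightarrow> (real \<times> real) set \<Rightarrow> nat" where
  "num_visited a b S = card {T \<in> tiles a b. visits S T}"

text \<open>The cardinality in \<^const>\<open>num_visited\<close> is always that of a finite set when the
  argument is a segment.\<close>

lemma finite_visited_segment:
  assumes "a > 0" "b > 0"
  shows "finite {T \<in> tiles a b. visits (segment l x y \<theta>) T}"
proof -
  have "bounded (segment l x y \<theta>)"
    by (simp add: segment_def bounded_closed_segment)
  then obtain B where B: "\<And>p. p \<in> segment l x y \<theta> \<Longrightarrow> norm p \<le> B"
    unfolding bounded_iff by blast
  have range: "k \<in> {\<lfloor>- B / c\<rfloor> - 1 .. \<lceil>B / c\<rceil>}"
    if "c > 0" "of_int k * c \<le> u" "u \<le> (of_int k + 1) * c" "\<bar>u\<bar> \<le> B" for c u :: real and k :: int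
  proof -
    have "of_int k \<le> B / c" "- B / c \<le> of_int k + 1"
      using that by (auto simp: field_simps)
    then show ?thesis by (simp, linarith)
  qed
  have "{T \<in> tiles a b. visits (segment l x y \<theta>) T} \<subseteq>
      (\<lambda>(k, m). tile a b k m) `
        ({\<lfloor>- B / a\<rfloor> - 1 .. \<lceil>B / a\<rceil>} \<times> {\<lfloor>- B / b\<rfloor> - 1 .. \<lceil>B / b\<rceil>})"
  proof
    fix T assume "T \<in> {T \<in> tiles a b. visits (segment l x y \<theta>) T}"
    then obtain k m u v where T: "T = tile a b k m" and uv: "(u, v) \<in> segment l x y \<theta>"
        "(u, v) \<in> tile a b k m"
      using interior_subset unfolding tiles_def visits_def by fast
    have "\<bar>u\<bar> \<le> B" "\<bar>v\<bar> \<le> B"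
      using B[OF uv(1)] norm_fst_le[of u v] norm_snd_le[of v u] by auto
    with uv(2) show "T \<in> (\<lambda>(k, m). tile a b k m) `
        ({\<lfloor>- B / a\<rfloor> - 1 .. \<lceil>B / a\<rceil>} \<times> {\<lfloor>- B / b\<rfloor> - 1 .. \<lceil>B / b\<rceil>})"
      unfolding T tile_def[of a b k m]
      using range[of a k u] range[of b m v] assms
      by (auto intro!: image_eqI[of _ _ "(k, m)"] simp: tile_def)
  qed
  then show ?thesis
    by (rule finite_subset) simp
qed

end

theory Submission
  imports Defs
begin

text \<open>
  A tile \<open>(k, m)\<close> is visited from \<open>(x, y)\<close> iff the tile \<open>(0, 0)\<close> is visited from
  \<open>(x - k a, y - m b)\<close>. Hence, for a fixed direction with displacement \<open>(u, v)\<close>, summing over all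
  tiles and integrating \<open>(x, y)\<close> over one cell unfolds to an integral over the whole plane: the area
  of the set of starting points whose segment meets one given open cell. For fixed \<open>x\<close>, let
  \<open>I x\<close> be the interval of times \<open>t \<in> [0, 1]\<close> at which \<open>x + t u \<in> (0, a)\<close>; the admissible \<open>y\<close> form
  an interval of length \<open>b + \<bar>v\<bar> \<bar>I x\<bar>\<close> if \<open>I x\<close> is nonempty, so by Tonelli the area is
  \<open>b (a + \<bar>u\<bar>) + \<bar>v\<bar> a\<close>. Dividing by \<open>a b\<close> and averaging \<open>\<bar>cos \<theta>\<bar>\<close> and \<open>\<bar>sin \<theta>\<bar>\<close>, each of mean
  \<open>2 / \<pi>\<close>, gives the formula.
\<close>

section \<open>Visiting a tile as hitting a translate of one open cell\<close>

text \<open>The strict inequalities are membership in the interior of the cell at the origin. An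
  arbitrary displacement \<open>(u, v)\<close> replaces length and angle, so the area is computed
  for all directions at once.\<close>

definition hits :: "real \<Rightarrow> real \<Rightarrow> real \<Rightarrow> real \<Rightarrow> real \<Rightarrow> real \<Rightarrow> bool" where
  "hits a b u v x y \<longleftrightarrow>
     (\<exists>t\<in>{0..1}. 0 < x + t * u \<and> x + t * u < a \<and> 0 < y + t * v \<and> y + t * v < b)"

text \<open>The existential ranges over uncountably many \<open>t\<close>, so measurability comes
  from topology: for each \<open>t\<close> the condition on \<open>(u, v, x, y)\<close> is open, and
  a union of open sets is open, hence Borel.\<close>

lemma pred_hits [measurable (raw)]:
  assumes [measurable]: "u \<in> borel_measurable M" "v \<in> borel_measurable M"
    "x \<in> borel_measurable M" "y \<in> borel_measurable M"
  shows "Measurable.pred M (\<lambda>w. hits a b (u w) (v w) (x w) (y w))"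
proof -
  let ?G = "\<lambda>t. {(u, v, x, y). 0 < x + t * u \<and> x + t * u < a \<and> 0 < y + t * v \<and> y + t * v < b}"
  have "open (?G t)" for t :: real
    unfolding case_prod_beta
    by (intro open_Collect_conj open_Collect_less continuous_intros)
  then have "open (\<Union>t\<in>{0..1}. ?G t)" by blast
  then have [measurable]: "(\<Union>t\<in>{0..1}. ?G t) \<in> sets borel" by simp
  have "Measurable.pred M (\<lambda>w. (u w, v w, x w, y w) \<in> (\<Union>t\<in>{0..1}. ?G t))"
    by measurable
  then show ?thesis by (simp add: hits_def Bex_def)
qed

lemma visits_segment_tile:
  assumes "a > 0" "b > 0"
  shows "visits (segment l x y \<theta>) (tile a b k m) \<longleftrightarrow>
    hits a b (l * cos \<theta>) (l * sin \<theta>) (x - of_int k * a) (y - of_int m * b)"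
proof -
  have "segment l x y \<theta> = (\<lambda>t. (x + t * (l * cos \<theta>), y + t * (l * sin \<theta>))) ` {0..1}"
    by (auto simp: segment_def closed_segment_def image_def algebra_simps)
  then show ?thesis
    unfolding visits_def tile_def hits_def interior_Times interior_atLeastAtMost_real
    by (auto simp: algebra_simps)
qed

text \<open>\<open>num_visited\<close> counts tiles as sets, while the unfolding sums over index
  pairs; injectivity makes the two counts agree.\<close>

lemma inj_tile:
  assumes "a > 0" "b > 0"
  shows "inj (\<lambda>(k, m). tile a b k m)"
proof (rule injI, clarify)
  fix k m k' m' assume "tile a b k m = tile a b k' m'"
  \<comment> \<open>Nonempty sides exclude the case of \<open>times_eq_iff\<close> in which both
    products are empty.\<close>
  moreover have "of_int k * a \<le> (of_int k + 1) * a" "of_int m * b \<le> (of_int m + 1) * b"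
    for k m using assms by (auto simp: algebra_simps)
  ultimately have "of_int k * a = of_int k' * a \<and> of_int m * b = of_int m' * b"
    unfolding tile_def by (simp add: times_eq_iff)
  then show "k = k' \<and> m = m'" using assms by simp
qed

section \<open>Counting visited tiles by counting measure\<close>

lemma nn_integral_count_space_pair:
  fixes f :: "'i::countable \<Rightarrow> 'j::countable \<Rightarrow> ennreal"
  shows "(\<integral>\<^sup>+p. f (fst p) (snd p) \<partial>count_space UNIV) =
    (\<integral>\<^sup>+i. \<integral>\<^sup>+j. f i j \<partial>count_space UNIV \<partial>count_space UNIV)"
proof -
  interpret sigma_finite_measure "count_space (UNIV :: 'j set)"
    by (rule sigma_finite_measure_count_space)
  show ?thesis
    using nn_integral_fst[of "\<lambda>p. f (fst p) (snd p)" "count_space (UNIV :: 'i set)"]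
    by (simp add: pair_measure_countable)
qed

lemma num_visited_eq_nn_integral:
  assumes "a > 0" "b > 0"
  shows "ennreal (real (num_visited a b (segment l x y \<theta>))) =
    (\<integral>\<^sup>+k. \<integral>\<^sup>+m. of_bool (hits a b (l * cos \<theta>) (l * sin \<theta>) (x - of_int k * a) (y - of_int m * b))
      \<partial>count_space UNIV \<partial>count_space UNIV)"
proof -
  let ?P = "{(k, m). visits (segment l x y \<theta>) (tile a b k m)}"
  have img: "{T \<in> tiles a b. visits (segment l x y \<theta>) T} = (\<lambda>(k, m). tile a b k m) ` ?P"
    by (auto simp: tiles_def)
  have inj: "inj_on (\<lambda>(k, m). tile a b k m) ?P"
    using inj_tile[OF assms] by (rule inj_on_subset) simp
  \<comment> \<open>For an infinite set \<open>card\<close> would be 0 but the counting measure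
    infinite; finiteness of the set of visited tiles pulls back along the injection.\<close>
  have fin: "finite ?P"
    using finite_visited_segment[OF assms, of l x y \<theta>] finite_imageD[OF _ inj] by (simp add: img)
  have "ennreal (real (num_visited a b (segment l x y \<theta>))) = of_nat (card ?P)"
    unfolding num_visited_def img by (subst card_image[OF inj]) (simp add: ennreal_of_nat_eq_real_of_nat)
  also have "\<dots> = emeasure (count_space UNIV) ?P"
    using fin by simp
  also have "\<dots> = (\<integral>\<^sup>+p. indicator ?P p \<partial>count_space UNIV)"
    by simp
  also have "\<dots> = (\<integral>\<^sup>+p. of_bool (hits a b (l * cos \<theta>) (l * sin \<theta>)
      (x - of_int (fst p) * a) (y - of_int (snd p) * b)) \<partial>count_space UNIV)"
    by (rule nn_integral_cong)
       (auto simp: indicator_def visits_segment_tile[OF assms] split: prod.splits)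
  finally show ?thesis
    unfolding nn_integral_count_space_pair[of "\<lambda>k m. of_bool (hits a b (l * cos \<theta>) (l * sin \<theta>)
      (x - of_int k * a) (y - of_int m * b))"] .
qed

section \<open>Unfolding sums over the grid to integrals over the plane\<close>

text \<open>Lets \<open>measurable\<close> see through the sums over tile indices: measurability for
  each of countably many indices gives joint measurability.\<close>

lemma borel_measurable_nn_integral_countable [measurable (raw)]:
  fixes f :: "'a \<Rightarrow> 'i::countable \<Rightarrow> ennreal"
  assumes [measurable]: "\<And>i. (\<lambda>x. f x i) \<in> borel_measurable M"
  shows "(\<lambda>x. \<integral>\<^sup>+i. f x i \<partial>count_space UNIV) \<in> borel_measurable M"
proof -
  interpret sigma_finite_measure "count_space (UNIV :: 'i set)"
    by (rule sigma_finite_measure_count_space)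
  have "(\<lambda>(x, i). f x i) \<in> borel_measurable (M \<Otimes>\<^sub>M count_space UNIV)"
    by measurable
  then show ?thesis by measurable
qed

text \<open>Exchange sum and integral, then translate the \<open>k\<close>-th term by
  \<open>k * a\<close>. The translates of the fundamental domain \<open>{0..<a}\<close> partition
  the line, so their indicators sum to 1.\<close>

lemma nn_integral_unfold_period:
  fixes f :: "real \<Rightarrow> ennreal"
  assumes [measurable]: "f \<in> borel_measurable borel" and "a > 0"
  shows "(\<integral>\<^sup>+x. (\<integral>\<^sup>+k. f (x - of_int k * a) \<partial>count_space UNIV) * indicator {0..<a} x \<partial>lborel) =
    (\<integral>\<^sup>+x. f x \<partial>lborel)"
proof -
  have one: "(\<integral>\<^sup>+k. indicator {0..<a} (x + of_int k * a) \<partial>count_space UNIV) = 1" for x :: real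
  proof -
    \<comment> \<open>Exactly one shift moves \<open>x\<close> into the half-open period: removing
      \<open>\<lfloor>x / a\<rfloor>\<close> copies of \<open>a\<close>.\<close>
    have "indicator {0..<a} (x + of_int k * a) = (indicator {- \<lfloor>x / a\<rfloor>} k :: ennreal)" for k :: int
    proof -
      have "x + of_int k * a \<in> {0..<a} \<longleftrightarrow> - of_int k \<le> x / a \<and> x / a < - of_int k + 1"
        using \<open>a > 0\<close> by (auto simp: field_simps)
      also have "\<dots> \<longleftrightarrow> k = - \<lfloor>x / a\<rfloor>"
        using floor_eq_iff[of "x / a" "- k"] by auto
      finally show ?thesis by (simp add: indicator_def)
    qed
    then show ?thesis by simp
  qed
  have "(\<integral>\<^sup>+x. (\<integral>\<^sup>+k. f (x - of_int k * a) \<partial>count_space UNIV) * indicator {0..<a} x \<partial>lborel) =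
    (\<integral>\<^sup>+x. (\<integral>\<^sup>+(k::int). f (x - of_int k * a) * indicator {0..<a} x \<partial>count_space UNIV) \<partial>lborel)"
    by (simp add: nn_integral_multc)
  also have "\<dots> = (\<integral>\<^sup>+(k::int). (\<integral>\<^sup>+x. f (x - of_int k * a) * indicator {0..<a} x \<partial>lborel)
      \<partial>count_space UNIV)"
    by (rule nn_integral_count_space_nn_integral) auto
  also have "\<dots> = (\<integral>\<^sup>+(k::int). (\<integral>\<^sup>+x. f x * indicator {0..<a} (x + of_int k * a) \<partial>lborel)
      \<partial>count_space UNIV)"
  proof (rule nn_integral_cong)
    fix k :: int
    show "(\<integral>\<^sup>+x. f (x - of_int k * a) * indicator {0..<a} x \<partial>lborel) =
      (\<integral>\<^sup>+x. f x * indicator {0..<a} (x + of_int k * a) \<partial>lborel)"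
      by (subst nn_integral_real_affine[where c = 1 and t = "of_int k * a"]) (simp_all add: add.commute)
  qed
  also have "\<dots> = (\<integral>\<^sup>+x. (\<integral>\<^sup>+(k::int). f x * indicator {0..<a} (x + of_int k * a) \<partial>count_space UNIV)
      \<partial>lborel)"
    by (rule nn_integral_count_space_nn_integral[symmetric]) auto
  also have "\<dots> = (\<integral>\<^sup>+x. f x \<partial>lborel)"
    by (simp add: nn_integral_cmult one)
  finally show ?thesis .
qed

text \<open>The one-dimensional unfolding is used twice: in \<open>y\<close> for each fixed
  \<open>k\<close>, after the sum over \<open>k\<close> has been moved outside, and then in
  \<open>x\<close> for the inner integral over \<open>y\<close>.\<close>

lemma nn_integral_unfold_grid:
  fixes g :: "real \<Rightarrow> real \<Rightarrow> ennreal"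
  assumes [measurable]: "case_prod g \<in> borel_measurable (borel \<Otimes>\<^sub>M borel)" and "a > 0" "b > 0"
  shows "(\<integral>\<^sup>+x. (\<integral>\<^sup>+y. (\<integral>\<^sup>+k. \<integral>\<^sup>+m. g (x - of_int k * a) (y - of_int m * b)
      \<partial>count_space UNIV \<partial>count_space UNIV) * indicator {0..<b} y \<partial>lborel) * indicator {0..<a} x \<partial>lborel) =
    (\<integral>\<^sup>+x. \<integral>\<^sup>+y. g x y \<partial>lborel \<partial>lborel)"
proof -
  have [measurable]: "case_prod g \<in> borel_measurable (borel \<Otimes>\<^sub>M lborel)"
    using assms(1) by (simp cong: measurable_cong_sets)
  have "(\<integral>\<^sup>+y. (\<integral>\<^sup>+k. \<integral>\<^sup>+m. g (x - of_int k * a) (y - of_int m * b)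
      \<partial>count_space UNIV \<partial>count_space UNIV) * indicator {0..<b} y \<partial>lborel) =
    (\<integral>\<^sup>+(k::int). \<integral>\<^sup>+y. g (x - of_int k * a) y \<partial>lborel \<partial>count_space UNIV)" for x
  proof -
    have "(\<integral>\<^sup>+y. (\<integral>\<^sup>+k. \<integral>\<^sup>+m. g (x - of_int k * a) (y - of_int m * b)
      \<partial>count_space UNIV \<partial>count_space UNIV) * indicator {0..<b} y \<partial>lborel) =
      (\<integral>\<^sup>+y. (\<integral>\<^sup>+(k::int). (\<integral>\<^sup>+m. g (x - of_int k * a) (y - of_int m * b)
        \<partial>count_space UNIV) * indicator {0..<b} y \<partial>count_space UNIV) \<partial>lborel)"
      by (simp add: nn_integral_multc)
    also have "\<dots> = (\<integral>\<^sup>+(k::int). (\<integral>\<^sup>+y. (\<integral>\<^sup>+m. g (x - of_int k * a) (y - of_int m * b)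
        \<partial>count_space UNIV) * indicator {0..<b} y \<partial>lborel) \<partial>count_space UNIV)"
      by (rule nn_integral_count_space_nn_integral) auto
    also have "\<dots> = (\<integral>\<^sup>+(k::int). \<integral>\<^sup>+y. g (x - of_int k * a) y \<partial>lborel \<partial>count_space UNIV)"
      using \<open>b > 0\<close> by (intro nn_integral_cong nn_integral_unfold_period) auto
    finally show ?thesis .
  qed
  then show ?thesis
    using nn_integral_unfold_period[of "\<lambda>x. \<integral>\<^sup>+y. g x y \<partial>lborel" a] \<open>a > 0\<close> by simp
qed

section \<open>Lengths of intervals, thickened and scaled\<close>

text \<open>Allows lengths to be computed without deciding which endpoints belong to
  \<open>J\<close>: both outer sets have the same measure.\<close>

lemma is_interval_sandwich:
  fixes J :: "real set"
  assumes "is_interval J" "J \<noteq> {}" "bounded J"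
  shows "{Inf J<..<Sup J} \<subseteq> J" "J \<subseteq> {Inf J..Sup J}"
proof -
  have bdd: "bdd_below J" "bdd_above J"
    using \<open>bounded J\<close> by (auto intro: bounded_imp_bdd_below bounded_imp_bdd_above)
  show "J \<subseteq> {Inf J..Sup J}"
    using bdd by (auto intro: cInf_lower cSup_upper)
  show "{Inf J<..<Sup J} \<subseteq> J"
  proof
    fix x assume "x \<in> {Inf J<..<Sup J}"
    then obtain p q where "p \<in> J" "p < x" "q \<in> J" "x < q"
      using cInf_less_iff[OF \<open>J \<noteq> {}\<close> bdd(1)] less_cSup_iff[OF \<open>J \<noteq> {}\<close> bdd(2)] by auto
    with \<open>is_interval J\<close> show "x \<in> J"
      unfolding is_interval_1 by (meson less_imp_le)
  qed
qed

lemma emeasure_lborel_is_interval: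
  fixes J :: "real set"
  assumes "is_interval J" "J \<noteq> {}" "bounded J"
  shows "emeasure lborel J = ennreal (Sup J - Inf J)"
proof -
  have "Inf J \<le> Sup J"
    using is_interval_sandwich(2)[OF assms] \<open>J \<noteq> {}\<close> by force
  moreover have "J \<in> sets lborel"
    using assms(1) by (simp add: real_interval_borel_measurable)
  ultimately show ?thesis
    using emeasure_mono[OF is_interval_sandwich(1)[OF assms], of lborel]
      emeasure_mono[OF is_interval_sandwich(2)[OF assms], of lborel]
    by (simp add: antisym)
qed

text \<open>The set is the Minkowski sum of \<open>J\<close> and \<open>(0, b)\<close>. The
  translates fuse into one open interval from \<open>Inf J\<close> to \<open>Sup J + b\<close>,
  whichever endpoints \<open>J\<close> contains.\<close>

lemma emeasure_interval_thickened:
  fixes J :: "real set"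
  assumes "is_interval J" "J \<noteq> {}" "bounded J" "b > 0"
  shows "emeasure lborel {y. \<exists>s\<in>J. s < y \<and> y < s + b} = ennreal b + emeasure lborel J"
proof -
  have bdd: "bdd_below J" "bdd_above J"
    using \<open>bounded J\<close> by (auto intro: bounded_imp_bdd_below bounded_imp_bdd_above)
  have le: "Inf J \<le> Sup J"
    using is_interval_sandwich(2)[OF assms(1-3)] \<open>J \<noteq> {}\<close> by force
  have "{y. \<exists>s\<in>J. s < y \<and> y < s + b} = {Inf J<..<Sup J + b}"
  proof (intro equalityI subsetI)
    fix y assume "y \<in> {y. \<exists>s\<in>J. s < y \<and> y < s + b}"
    then show "y \<in> {Inf J<..<Sup J + b}"
      using is_interval_sandwich(2)[OF assms(1-3)] by fastforce
  next
    fix y assume "y \<in> {Inf J<..<Sup J + b}"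
    then have "Inf J < y" "y - b < Sup J" by auto
    then obtain p q where pq: "p \<in> J" "p < y" "q \<in> J" "y - b < q"
      using cInf_less_iff[OF \<open>J \<noteq> {}\<close> bdd(1)] less_cSup_iff[OF \<open>J \<noteq> {}\<close> bdd(2)] by auto
    \<comment> \<open>In the first two cases \<open>p\<close> or \<open>q\<close> serves as
      \<open>s\<close>. Otherwise \<open>y - b / 2\<close> lies between \<open>p\<close> and
      \<open>q\<close>, hence in \<open>J\<close>, and serves instead.\<close>
    consider "y < p + b" | "q < y" | "p \<le> y - b" "y \<le> q" by linarith
    then show "y \<in> {y. \<exists>s\<in>J. s < y \<and> y < s + b}"
    proof cases
      case 3
      with \<open>b > 0\<close> have "p \<le> y - b / 2" "y - b / 2 \<le> q" by auto
      with pq have "y - b / 2 \<in> J"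
        using assms(1) unfolding is_interval_1 by blast
      then show ?thesis using \<open>b > 0\<close> by force
    qed (use pq in auto)
  qed
  then show ?thesis
    using le \<open>b > 0\<close> emeasure_lborel_is_interval[OF assms(1-3)]
    by (simp flip: ennreal_plus add: algebra_simps)
qed

text \<open>Being an interval makes both sets Borel, so the scaling law for \<open>lebesgue\<close>
  carries over to \<open>lborel\<close>. The factor may be negative, or zero for segments parallel
  to an axis.\<close>

lemma emeasure_lborel_image_mult_is_interval:
  fixes I :: "real set"
  assumes "is_interval I"
  shows "emeasure lborel ((\<lambda>t. c * t) ` I) = ennreal \<bar>c\<bar> * emeasure lborel I"
proof -
  have "is_interval ((\<lambda>t. c * t) ` I)"
    using assms unfolding is_interval_convex_1 by (rule convex_scaling[of I c, unfolded real_scaleR_def])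
  then have "I \<in> sets lborel" "(\<lambda>t. c * t) ` I \<in> sets lborel"
    using assms by (simp_all add: real_interval_borel_measurable)
  then show ?thesis
    using emeasure_lebesgue_affine[of c 0 I] by simp
qed

section \<open>Integrals of absolute sine and cosine over a full turn\<close>

text \<open>On each quarter turn sine and cosine keep their signs, so the fundamental theorem of
  calculus applies; all four quarters contribute the same value \<open>?r\<close>.\<close>

lemma nn_integral_abs_sin_cos:
  assumes "A \<ge> 0" "B \<ge> 0" "C \<ge> 0"
  shows "(\<integral>\<^sup>+\<theta>. ennreal (A + B * \<bar>sin \<theta>\<bar> + C * \<bar>cos \<theta>\<bar>) * indicator {0..<2 * pi} \<theta> \<partial>lborel) =
    ennreal (2 * pi * A + 4 * B + 4 * C)"
proof -
  let ?f = "\<lambda>\<theta>. A + B * \<bar>sin \<theta>\<bar> + C * \<bar>cos \<theta>\<bar>"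
  let ?r = "A * (pi / 2) + B + C"
  \<comment> \<open>\<open>\<epsilon>\<close> and \<open>\<delta>\<close> are the signs of sine and
    cosine on \<open>{p..q}\<close>; the second premise evaluates the antiderivative at the
    endpoints.\<close>
  have piece: "(?f has_integral ?r) {p..q}"
    if "p \<le> q" "A * (q - p) - B * \<epsilon> * (cos q - cos p) + C * \<delta> * (sin q - sin p) = ?r" "\<And>x. p \<le> x \<Longrightarrow> x \<le> q \<Longrightarrow> \<bar>sin x\<bar> = \<epsilon> * sin x \<and> \<bar>cos x\<bar> = \<delta> * cos x" for p q \<epsilon> \<delta> :: real
  proof -
    have "((\<lambda>\<theta>. A + B * \<epsilon> * sin \<theta> + C * \<delta> * cos \<theta>) has_integral
      ((A * q - B * \<epsilon> * cos q + C * \<delta> * sin q) - (A * p - B * \<epsilon> * cos p + C * \<delta> * sin p))) {p..q}"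
      using that(1) by (intro fundamental_theorem_of_calculus)
        (auto intro!: derivative_eq_intros simp flip: has_real_derivative_iff_has_vector_derivative)
    moreover have "A + B * \<epsilon> * sin \<theta> + C * \<delta> * cos \<theta> = ?f \<theta>" if "\<theta> \<in> {p..q}" for \<theta>
      using \<open>\<And>x. p \<le> x \<Longrightarrow> x \<le> q \<Longrightarrow> \<bar>sin x\<bar> = \<epsilon> * sin x \<and> \<bar>cos x\<bar> = \<delta> * cos x\<close>[of \<theta>] that by simp
    ultimately have "(?f has_integral
      ((A * q - B * \<epsilon> * cos q + C * \<delta> * sin q) - (A * p - B * \<epsilon> * cos p + C * \<delta> * sin p))) {p..q}"
      by (rule has_integral_eq[rotated])
    then show ?thesis unfolding that(2)[symmetric] by (simp add: algebra_simps)
  qed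
  have s1: "\<bar>sin x\<bar> = 1 * sin x" if "0 \<le> x" "x \<le> pi" for x
    using sin_ge_zero[OF that] by simp
  have s2: "\<bar>sin x\<bar> = - 1 * sin x" if "pi \<le> x" "x \<le> 2 * pi" for x
    using sin_ge_zero[of "x - pi"] that by (simp add: sin_diff)
  have c1: "\<bar>cos x\<bar> = 1 * cos x" if "0 \<le> x" "x \<le> pi / 2" for x
    using cos_ge_zero[of x] that by simp
  have c2: "\<bar>cos x\<bar> = - 1 * cos x" if "pi / 2 \<le> x" "x \<le> 3 * pi / 2" for x
    using cos_ge_zero[of "x - pi"] that by (simp add: cos_diff)
  have c3: "\<bar>cos x\<bar> = 1 * cos x" if "3 * pi / 2 \<le> x" "x \<le> 2 * pi" for x
    using cos_ge_zero[of "x - 2 * pi"] that by (simp add: cos_diff)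
  have v: "cos (pi * 3 / 2) = 0" "sin (pi * 3 / 2) = -1"
    using cos_3over2_pi sin_3over2_pi by (simp_all add: mult.commute)
  have 1: "(?f has_integral ?r) {0..pi / 2}"
  proof (rule piece)
    show "\<bar>sin x\<bar> = 1 * sin x \<and> \<bar>cos x\<bar> = 1 * cos x" if "0 \<le> x" "x \<le> pi / 2" for x
      using s1[of x] c1[of x] that pi_gt_zero by linarith
  qed (auto simp: v algebra_simps)
  have 2: "(?f has_integral ?r) {pi / 2..pi}"
  proof (rule piece)
    show "\<bar>sin x\<bar> = 1 * sin x \<and> \<bar>cos x\<bar> = - 1 * cos x" if "pi / 2 \<le> x" "x \<le> pi" for x
      using s1[of x] c2[of x] that pi_gt_zero by linarith
  qed (auto simp: v algebra_simps)
  have 3: "(?f has_integral ?r) {pi..3 * pi / 2}"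
  proof (rule piece)
    show "\<bar>sin x\<bar> = - 1 * sin x \<and> \<bar>cos x\<bar> = - 1 * cos x" if "pi \<le> x" "x \<le> 3 * pi / 2" for x
      using s2[of x] c2[of x] that pi_gt_zero by linarith
  qed (auto simp: v algebra_simps)
  have 4: "(?f has_integral ?r) {3 * pi / 2..2 * pi}"
  proof (rule piece)
    show "\<bar>sin x\<bar> = - 1 * sin x \<and> \<bar>cos x\<bar> = 1 * cos x" if "3 * pi / 2 \<le> x" "x \<le> 2 * pi" for x
      using s2[of x] c3[of x] that pi_gt_zero by linarith
  qed (auto simp: v algebra_simps)
  have "(?f has_integral (?r + ?r + ?r + ?r)) {0..2 * pi}"
    by (rule has_integral_combine[OF _ _ has_integral_combine[OF _ _ has_integral_combine[OF _ _ 1 2] 3] 4]) auto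
  then have "(\<integral>\<^sup>+\<theta>. ennreal (?f \<theta>) * indicator {0..2 * pi} \<theta> \<partial>lborel) = ennreal (?r + ?r + ?r + ?r)"
    using assms by (intro nn_integral_has_integral_lebesgue') auto
  also have "?r + ?r + ?r + ?r = 2 * pi * A + 4 * B + 4 * C"
    by (simp add: algebra_simps)
  finally have "(\<integral>\<^sup>+\<theta>. ennreal (?f \<theta>) * indicator {0..2 * pi} \<theta> \<partial>lborel) =
      ennreal (2 * pi * A + 4 * B + 4 * C)" .
  \<comment> \<open>The closed and the half-open range differ by the null set
    \<open>{2 * pi}\<close>.\<close>
  moreover have "(\<integral>\<^sup>+\<theta>. ennreal (?f \<theta>) * indicator {0..<2 * pi} \<theta> \<partial>lborel) =
      (\<integral>\<^sup>+\<theta>. ennreal (?f \<theta>) * indicator {0..2 * pi} \<theta> \<partial>lborel)"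
    by (rule nn_integral_cong_AE, rule AE_mp[OF AE_lborel_singleton[of "2 * pi"]]) (auto simp: indicator_def)
  ultimately show ?thesis by simp
qed

section \<open>Area of the starting points whose segment meets one cell\<close>

lemma nn_integral_hits:
  assumes "a > 0" "b > 0"
  shows "(\<integral>\<^sup>+x. \<integral>\<^sup>+y. of_bool (hits a b u v x y) \<partial>lborel \<partial>lborel) =
    ennreal (a * b + b * \<bar>u\<bar> + a * \<bar>v\<bar>)"
proof -
  define I where "I x = {t \<in> {0..1}. 0 < x + t * u \<and> x + t * u < a}" for x
  have I_int: "is_interval (I x)" for x
  proof -
    have "t \<in> I x" if "p \<in> I x" "q \<in> I x" "p \<le> t" "t \<le> q" for p q t
    proof (cases "u \<ge> 0")
      case True
      then have "p * u \<le> t * u" "t * u \<le> q * u" using that by (auto intro: mult_right_mono)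
      with that show ?thesis by (auto simp: I_def)
    next
      case False
      then have "q * u \<le> t * u" "t * u \<le> p * u" using that by (auto intro: mult_right_mono_neg)
      with that show ?thesis by (auto simp: I_def)
    qed
    then show ?thesis unfolding is_interval_1 by blast
  qed
  have I_bdd: "bounded (I x)" for x
    by (rule bounded_subset[of "{0..1}"]) (auto simp: I_def)
  have scaled: "is_interval ((\<lambda>t. c * t) ` J)" "bounded ((\<lambda>t. c * t) ` J)"
    if "is_interval J" "bounded J" for c :: real and J
    using that convex_scaling[of J c] bounded_scaling[of J c] by (simp_all add: is_interval_convex_1)
  \<comment> \<open>These \<open>x\<close> form the interval of values \<open>- u * t\<close>, of
    length \<open>\<bar>u\<bar>\<close>, thickened by \<open>a\<close>.\<close>
  have projection: "(\<integral>\<^sup>+x. of_bool (I x \<noteq> {}) \<partial>lborel) = ennreal (a + \<bar>u\<bar>)"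
    and [measurable]: "Measurable.pred borel (\<lambda>x. I x \<noteq> {})"
  proof -
    have eq: "{x. I x \<noteq> {}} = {x. \<exists>s\<in>(\<lambda>t. - u * t) ` {0..1}. s < x \<and> x < s + a}"
    proof -
      have "0 < x + t * u \<and> x + t * u < a \<longleftrightarrow> - u * t < x \<and> x < - u * t + a" for x t
        by (auto simp: algebra_simps)
      then show ?thesis unfolding I_def by blast
    qed
    have "open {x. I x \<noteq> {}}"
    proof -
      have "{x. I x \<noteq> {}} = (\<Union>t\<in>{0..1}. {- t * u<..<a - t * u})"
      proof -
        have "0 < x + t * u \<and> x + t * u < a \<longleftrightarrow> x \<in> {- t * u<..<a - t * u}" for x t
          by auto
        then show ?thesis unfolding I_def by blast
      qed
      then show ?thesis by auto
    qed
    then have [measurable]: "{x. I x \<noteq> {}} \<in> sets borel" by simp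
    then show "Measurable.pred borel (\<lambda>x. I x \<noteq> {})" by (simp add: pred_def)
    have "(\<integral>\<^sup>+x. of_bool (I x \<noteq> {}) \<partial>lborel) = (\<integral>\<^sup>+x. indicator {x. I x \<noteq> {}} x \<partial>lborel)"
      by (intro nn_integral_cong) (simp add: indicator_def)
    also have "\<dots> = emeasure lborel {x. I x \<noteq> {}}" by simp
    also have "\<dots> = ennreal a + ennreal \<bar>- u\<bar> * emeasure lborel {0..1::real}"
      unfolding eq using scaled[of "{0..1}" "- u"] \<open>a > 0\<close>
      by (subst emeasure_interval_thickened)
         (auto simp only: is_interval_cc bounded_closed_interval emeasure_lborel_image_mult_is_interval
            image_is_empty atLeastatMost_empty_iff)
    finally show "(\<integral>\<^sup>+x. of_bool (I x \<noteq> {}) \<partial>lborel) = ennreal (a + \<bar>u\<bar>)"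
      using \<open>a > 0\<close> by (simp flip: ennreal_plus)
  qed
  \<comment> \<open>Length as an integral over \<open>t\<close> serves both Tonelli and
    measurability in \<open>x\<close>.\<close>
  have I_emeasure: "emeasure lborel (I x) =
      (\<integral>\<^sup>+t. of_bool (0 < x + t * u \<and> x + t * u < a) * indicator {0..1} t \<partial>lborel)" for x
  proof -
    have "emeasure lborel (I x) = (\<integral>\<^sup>+t. indicator (I x) t \<partial>lborel)"
      using I_int[of x] by (simp add: real_interval_borel_measurable)
    also have "\<dots> = (\<integral>\<^sup>+t. of_bool (0 < x + t * u \<and> x + t * u < a) * indicator {0..1} t \<partial>lborel)"
      by (intro nn_integral_cong) (auto simp: I_def indicator_def)
    finally show ?thesis .
  qed
  \<comment> \<open>With the order exchanged, each time \<open>t\<close> admits an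
    \<open>x\<close>-interval of length \<open>a\<close>, independent of \<open>t\<close> and
    \<open>u\<close>; the times fill \<open>[0, 1]\<close>.\<close>
  have occupation: "(\<integral>\<^sup>+x. emeasure lborel (I x) \<partial>lborel) = ennreal a"
  proof -
    have "(\<integral>\<^sup>+x. emeasure lborel (I x) \<partial>lborel) =
      (\<integral>\<^sup>+t. \<integral>\<^sup>+x. of_bool (0 < x + t * u \<and> x + t * u < a) * indicator {0..1} t \<partial>lborel \<partial>lborel)"
      unfolding I_emeasure by (rule lborel_pair.Fubini'[symmetric]) measurable
    also have "\<dots> = (\<integral>\<^sup>+t. ennreal a * indicator {0..1::real} t \<partial>lborel)"
    proof (rule nn_integral_cong)
      fix t :: real
      have "(\<integral>\<^sup>+x. of_bool (0 < x + t * u \<and> x + t * u < a) \<partial>lborel) =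
        (\<integral>\<^sup>+x. indicator {- t * u<..<a - t * u} x \<partial>lborel)"
        by (intro nn_integral_cong) (auto simp: indicator_def)
      also have "\<dots> = ennreal a" using \<open>a > 0\<close> by simp
      finally show "(\<integral>\<^sup>+x. of_bool (0 < x + t * u \<and> x + t * u < a) * indicator {0..1} t \<partial>lborel) =
        ennreal a * indicator {0..1} t"
        by (simp add: nn_integral_multc)
    qed
    also have "\<dots> = ennreal a" by (simp add: nn_integral_cmult_indicator)
    finally show ?thesis .
  qed
  have "(\<integral>\<^sup>+y. of_bool (hits a b u v x y) \<partial>lborel) =
      of_bool (I x \<noteq> {}) * ennreal b + ennreal \<bar>v\<bar> * emeasure lborel (I x)" for x
  proof (cases "I x = {}")
    case True
    then have "\<not> hits a b u v x y" for y by (auto simp: hits_def I_def)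
    with True show ?thesis by simp
  next
    case False
    \<comment> \<open>The time \<open>t\<close> admits exactly the \<open>y\<close> between
      \<open>- v * t\<close> and \<open>- v * t + b\<close>, so the slice is the image of
      \<open>I x\<close> thickened by \<open>b\<close>.\<close>
    have eq: "{y. hits a b u v x y} = {y. \<exists>s\<in>(\<lambda>t. - v * t) ` I x. s < y \<and> y < s + b}"
      by (auto simp: hits_def I_def algebra_simps)
    have "(\<integral>\<^sup>+y. of_bool (hits a b u v x y) \<partial>lborel) = (\<integral>\<^sup>+y. indicator {y. hits a b u v x y} y \<partial>lborel)"
      by (intro nn_integral_cong) (simp add: indicator_def)
    also have "\<dots> = emeasure lborel {y. hits a b u v x y}"
      by (rule nn_integral_indicator) measurable
    also have "\<dots> = ennreal b + ennreal \<bar>- v\<bar> * emeasure lborel (I x)"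
      unfolding eq using scaled[OF I_int I_bdd, of "- v" x] False \<open>b > 0\<close>
      by (subst emeasure_interval_thickened)
         (auto simp only: emeasure_lborel_image_mult_is_interval[OF I_int] image_is_empty)
    finally show ?thesis using False by simp
  qed
  then have "(\<integral>\<^sup>+x. \<integral>\<^sup>+y. of_bool (hits a b u v x y) \<partial>lborel \<partial>lborel) =
    (\<integral>\<^sup>+x. of_bool (I x \<noteq> {}) * ennreal b + ennreal \<bar>v\<bar> * emeasure lborel (I x) \<partial>lborel)"
    by simp
  also have "\<dots> = ennreal (a + \<bar>u\<bar>) * ennreal b + ennreal \<bar>v\<bar> * ennreal a"
  proof -
    have [measurable]: "(\<lambda>x. emeasure lborel (I x)) \<in> borel_measurable borel"
      unfolding I_emeasure by measurable
    show ?thesis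
      by (subst nn_integral_add) (simp_all add: nn_integral_multc nn_integral_cmult projection occupation)
  qed
  also have "\<dots> = ennreal (a * b + b * \<bar>u\<bar> + a * \<bar>v\<bar>)"
    using assms by (simp add: algebra_simps flip: ennreal_mult ennreal_plus)
  finally show ?thesis .
qed

section \<open>Independent uniform starting point and angle\<close>

text \<open>Independence makes the joint law a product measure, whose coordinates are then split off
  one at a time. The third variable goes outermost, so that the starting point can be averaged for a
  fixed angle.\<close>

lemma (in prob_space) nn_integral_indep_vars_3:
  fixes X Y Z :: "'a \<Rightarrow> real" and F :: "real \<times> real \<times> real \<Rightarrow> ennreal"
  assumes indep: "indep_vars (\<lambda>_. borel) (\<lambda>i. [X, Y, Z] ! i) {..<3}"
    and F [measurable]: "F \<in> borel_measurable (borel \<Otimes>\<^sub>M borel \<Otimes>\<^sub>M borel)"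
  shows "(\<integral>\<^sup>+\<omega>. F (X \<omega>, Y \<omega>, Z \<omega>) \<partial>M) =
    (\<integral>\<^sup>+z. \<integral>\<^sup>+x. \<integral>\<^sup>+y. F (x, y, z) \<partial>distr M borel Y \<partial>distr M borel X \<partial>distr M borel Z)"
proof -
  have rv: "[X, Y, Z] ! i \<in> borel_measurable M" if "i < 3" for i
    using indep that by (auto simp: indep_vars_def)
  from rv[of 0] rv[of 1] rv[of 2]
  have [measurable]: "X \<in> borel_measurable M" "Y \<in> borel_measurable M" "Z \<in> borel_measurable M"
    by simp_all
  \<comment> \<open>\<open>product_sigma_finite\<close> speaks of every natural index, whereas
    \<open>[X, Y, Z] ! i\<close> is only determined for \<open>i < 3\<close>; \<open>D\<close>
    repeats the law of \<open>Z\<close> beyond.\<close>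
  define D where "D i = distr M borel (if i = 0 then X else if i = 1 then Y else Z)" for i :: nat
  have D_simps: "D 0 = distr M borel X" "D (Suc 0) = distr M borel Y" "D 2 = distr M borel Z"
    by (simp_all add: D_def)
  have sets_D [measurable_cong]: "sets (D i) = sets borel" for i by (simp add: D_def)
  have "prob_space (D i)" for i
    unfolding D_def by (rule prob_space_distr) simp
  then interpret product_sigma_finite D
    by (auto simp: product_sigma_finite_def intro: prob_space_imp_sigma_finite)
  \<comment> \<open>The order of insertion fixes the order of integration.\<close>
  have three: "{..<3} = insert 2 (insert 0 {Suc 0})" by auto
  let ?T = "\<lambda>\<omega>. \<lambda>i\<in>{..<3}. ([X, Y, Z] ! i) \<omega>" and ?F = "\<lambda>w::nat \<Rightarrow> real. F (w 0, w 1, w 2)"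
  have "distr M (Pi\<^sub>M {..<3} (\<lambda>_. borel)) ?T = Pi\<^sub>M {..<3} (\<lambda>i. distr M borel ([X, Y, Z] ! i))"
    using indep rv by (subst indep_vars_iff_distr_eq_PiM'[symmetric]) (auto simp: three)
  also have "\<dots> = Pi\<^sub>M {..<3} D"
    by (intro PiM_cong) (auto simp: D_def numeral_3_eq_3 less_Suc_eq)
  finally have law: "distr M (Pi\<^sub>M {..<3} (\<lambda>_. borel)) ?T = Pi\<^sub>M {..<3} D" .
  have [measurable]: "?T \<in> measurable M (Pi\<^sub>M {..<3} (\<lambda>_. borel))"
    using rv by (intro measurable_restrict) auto
  have "(\<integral>\<^sup>+\<omega>. F (X \<omega>, Y \<omega>, Z \<omega>) \<partial>M) = (\<integral>\<^sup>+\<omega>. ?F (?T \<omega>) \<partial>M)"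
    by simp
  also have "\<dots> = (\<integral>\<^sup>+w. ?F w \<partial>distr M (Pi\<^sub>M {..<3} (\<lambda>_. borel)) ?T)"
    by (rule nn_integral_distr[symmetric]) measurable
  also have "\<dots> = (\<integral>\<^sup>+w. ?F w \<partial>Pi\<^sub>M (insert 2 (insert 0 {Suc 0})) D)"
    unfolding law by (simp only: three)
  also have "\<dots> = (\<integral>\<^sup>+z. \<integral>\<^sup>+w. F (w 0, w (Suc 0), z) \<partial>Pi\<^sub>M (insert 0 {Suc 0}) D \<partial>D 2)"
    by (subst product_nn_integral_insert_rev) (simp_all, measurable)
  also have "\<dots> = (\<integral>\<^sup>+z. \<integral>\<^sup>+x. \<integral>\<^sup>+w. F (x, w (Suc 0), z) \<partial>Pi\<^sub>M {Suc 0} D \<partial>D 0 \<partial>D 2)"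
    by (subst product_nn_integral_insert_rev) (simp_all, measurable)
  also have "\<dots> = (\<integral>\<^sup>+z. \<integral>\<^sup>+x. \<integral>\<^sup>+y. F (x, y, z) \<partial>D (Suc 0) \<partial>D 0 \<partial>D 2)"
    by (subst product_nn_integral_singleton) simp_all
  finally show ?thesis by (simp only: D_simps)
qed

text \<open>Moves from the target \<open>lborel\<close> to \<open>borel\<close>:
  \<open>distr\<close> depends only on the sigma-algebra of its target.\<close>

lemma nn_integral_distr_uniform:
  fixes X :: "'w \<Rightarrow> real" and f :: "real \<Rightarrow> ennreal"
  assumes "distr M lborel X = uniform_measure lborel {0..<c}" "c > 0"
    and [measurable]: "f \<in> borel_measurable borel"
  shows "(\<integral>\<^sup>+x. f x \<partial>distr M borel X) = (\<integral>\<^sup>+x. f x * indicator {0..<c} x \<partial>lborel) / ennreal c"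
proof -
  have "distr M borel X = uniform_measure lborel {0..<c}"
    unfolding assms(1)[symmetric] by (rule distr_cong) simp_all
  then show ?thesis using \<open>c > 0\<close> by (simp add: nn_integral_uniform_measure)
qed

section \<open>The expected number of visited tiles\<close>

theorem theorem6:
  fixes a b l :: real
    and M :: "'w measure" and X Y \<Theta> :: "'w \<Rightarrow> real"
  assumes "a > 0" and "b > 0" and "l > 0"
    and "prob_space M"
    and "prob_space.indep_vars M (\<lambda>_. borel) (\<lambda>i. [X, Y, \<Theta>] ! i) {..<3}"
    and "distr M lborel X = uniform_measure lborel {0..<a}"
    and "distr M lborel Y = uniform_measure lborel {0..<b}"
    and "distr M lborel \<Theta> = uniform_measure lborel {0..<2 * pi}"
  shows "integrable M (\<lambda>\<omega>. real (num_visited a b (segment l (X \<omega>) (Y \<omega>) (\<Theta> \<omega>)))) \<and>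
    prob_space.expectation M (\<lambda>\<omega>. real (num_visited a b (segment l (X \<omega>) (Y \<omega>) (\<Theta> \<omega>))))
      = 2 * l / pi * (1 / a + 1 / b) + 1"
proof -
  interpret prob_space M by fact
  let ?N = "\<lambda>\<omega>. real (num_visited a b (segment l (X \<omega>) (Y \<omega>) (\<Theta> \<omega>)))"
  define G :: "real \<Rightarrow> real \<Rightarrow> real \<Rightarrow> ennreal"
    where "G \<theta> x y = of_bool (hits a b (l * cos \<theta>) (l * sin \<theta>) x y)" for \<theta> x y
  define F where "F = (\<lambda>(x, y, \<theta>). \<integral>\<^sup>+k. \<integral>\<^sup>+m. G \<theta> (x - of_int k * a) (y - of_int m * b)
      \<partial>count_space UNIV \<partial>count_space UNIV)"
  have [measurable]: "F \<in> borel_measurable (borel \<Otimes>\<^sub>M borel \<Otimes>\<^sub>M borel)"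
    unfolding F_def G_def by measurable
  have G_meas: "case_prod (G \<theta>) \<in> borel_measurable (borel \<Otimes>\<^sub>M borel)" for \<theta>
    unfolding G_def by measurable
  have N_eq: "ennreal (?N \<omega>) = F (X \<omega>, Y \<omega>, \<Theta> \<omega>)" for \<omega>
    using assms(1,2) by (simp add: F_def G_def num_visited_eq_nn_integral)
  have rv: "[X, Y, \<Theta>] ! i \<in> borel_measurable M" if "i < 3" for i
    using assms(5) that by (auto simp: indep_vars_def)
  from rv[of 0] rv[of 1] rv[of 2]
  have [measurable]: "X \<in> borel_measurable M" "Y \<in> borel_measurable M" "\<Theta> \<in> borel_measurable M"
    by simp_all
  \<comment> \<open>The count inherits measurability from the Borel function \<open>F\<close>, a
    countable sum of hit indicators.\<close>
  have "?N = (\<lambda>\<omega>. enn2real (F (X \<omega>, Y \<omega>, \<Theta> \<omega>)))"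
    by (simp flip: N_eq)
  also have "\<dots> \<in> borel_measurable M" by measurable
  finally have N_meas: "?N \<in> borel_measurable M" .
  \<comment> \<open>The mean for a fixed angle: unfolding turns it into the area for one cell
    divided by \<open>a * b\<close>.\<close>
  have xy: "(\<integral>\<^sup>+x. \<integral>\<^sup>+y. F (x, y, \<theta>) \<partial>distr M borel Y \<partial>distr M borel X) =
    ennreal (1 + l / a * \<bar>cos \<theta>\<bar> + l / b * \<bar>sin \<theta>\<bar>)" for \<theta>
  proof -
    have "(\<integral>\<^sup>+x. \<integral>\<^sup>+y. F (x, y, \<theta>) \<partial>distr M borel Y \<partial>distr M borel X) =
      (\<integral>\<^sup>+x. ((\<integral>\<^sup>+y. F (x, y, \<theta>) * indicator {0..<b} y \<partial>lborel) / ennreal b) *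
        indicator {0..<a} x \<partial>lborel) / ennreal a"
      using assms(1,2,6,7) by (simp add: nn_integral_distr_uniform)
    also have "\<dots> = (\<integral>\<^sup>+x. ((\<integral>\<^sup>+y. F (x, y, \<theta>) * indicator {0..<b} y \<partial>lborel) *
        indicator {0..<a} x) / ennreal b \<partial>lborel) / ennreal a"
      by (simp add: divide_ennreal_def ac_simps)
    also have "\<dots> = (\<integral>\<^sup>+x. \<integral>\<^sup>+y. G \<theta> x y \<partial>lborel \<partial>lborel) / ennreal b / ennreal a"
    proof -
      have "(\<lambda>x. (\<integral>\<^sup>+y. F (x, y, \<theta>) * indicator {0..<b} y \<partial>lborel) * indicator {0..<a} x)
          \<in> borel_measurable lborel" by measurable
      then show ?thesis
        using nn_integral_unfold_grid[OF G_meas assms(1,2), of \<theta>]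
        by (simp add: nn_integral_divide) (simp add: F_def)
    qed
    also have "\<dots> = ennreal ((a * b + b * \<bar>l * cos \<theta>\<bar> + a * \<bar>l * sin \<theta>\<bar>) / b / a)"
      using assms(1,2) by (simp add: G_def nn_integral_hits divide_ennreal del: ennreal_plus)
    also have "(a * b + b * \<bar>l * cos \<theta>\<bar> + a * \<bar>l * sin \<theta>\<bar>) / b / a =
        1 + l / a * \<bar>cos \<theta>\<bar> + l / b * \<bar>sin \<theta>\<bar>"
      using assms(1-3) by (simp add: abs_mult field_simps)
    finally show ?thesis .
  qed
  have "(\<integral>\<^sup>+\<omega>. ennreal (?N \<omega>) \<partial>M) = (\<integral>\<^sup>+\<omega>. F (X \<omega>, Y \<omega>, \<Theta> \<omega>) \<partial>M)"
    by (simp only: N_eq)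
  also have "\<dots> = (\<integral>\<^sup>+\<theta>. ennreal (1 + l / a * \<bar>cos \<theta>\<bar> + l / b * \<bar>sin \<theta>\<bar>) \<partial>distr M borel \<Theta>)"
    by (subst nn_integral_indep_vars_3[OF assms(5)]) (simp_all add: xy)
  also have "\<dots> = (\<integral>\<^sup>+\<theta>. ennreal (1 + l / b * \<bar>sin \<theta>\<bar> + l / a * \<bar>cos \<theta>\<bar>) *
      indicator {0..<2 * pi} \<theta> \<partial>lborel) / ennreal (2 * pi)"
    by (subst nn_integral_distr_uniform[OF assms(8)]) (simp_all add: add_ac)
  also have "\<dots> = ennreal (2 * pi * 1 + 4 * (l / b) + 4 * (l / a)) / ennreal (2 * pi)"
    using assms(1-3) by (subst nn_integral_abs_sin_cos) simp_all
  also have "\<dots> = ennreal ((2 * pi * 1 + 4 * (l / b) + 4 * (l / a)) / (2 * pi))"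
    using assms(1-3) by (intro divide_ennreal) simp_all
  also have "(2 * pi * 1 + 4 * (l / b) + 4 * (l / a)) / (2 * pi) = 2 * l / pi * (1 / a + 1 / b) + 1"
    using assms(1-3) by (simp add: field_simps)
  \<comment> \<open>A finite nonnegative integral of a measurable function gives integrability and
    the expectation together.\<close>
  finally show ?thesis
    using assms(1-3) N_meas by (subst (asm) nn_integral_eq_integrable) simp_all
qed

end
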